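(* For all $l,k\in\{1,\dots,L\}$ and all $\varphi=(\varphi_{\alpha_1},\dots,\varphi_{\alpha_G})\in L_2(\Omega_T)^G$, the functions $(\mathbf A^*\varphi)^{(l)}$ on $\bar\Omega^{g,l}$ and $(\mathbf A^*\varphi)^{(k)}$ on $\bar\Omega^{g,k}$ agree up to the factor $\gamma_l/\gamma_k$ and translation, that is, $$(\mathbf A^*\varphi)^{(l)}(\mathbf r+h_l\alpha_g)=\frac{\gamma_l}{\gamma_k}\,(\mathbf A^*\varphi)^{(k)}(\mathbf r+h_k\alpha_g)\qquad\text{for all } \mathbf r\in\bar\Omega_T^g .$$
   Context: Let $G,L\ge1$ be integers, let $\alpha_g=(\cos\theta_g,\sin\theta_g)\in\mathbb R^2$, $g=1,\dots,G$, be pairwise distinct with $\theta_g\in[0,2\pi)$, $0\le\theta_g<\theta_{g+1}$ for $g=1,\dots,G-1$, and let $0<h_1<\dots<h_L$. The aperture $\Omega_T=\{\mathbf r\in\mathbb R^2:\|\mathbf r\|\le T\}$ is the closed disc of radius $T>0$ centered at the origin; $\Omega_T(h_l\alpha_g)=\{\mathbf r\in\mathbb R^2:\mathbf r-h_l\alpha_g\in\Omega_T\}$ and $\Omega_l=\bigcup_{g=1}^G\Omega_T(h_l\alpha_g)$. The atmospheric tomography operator is $\mathbf A:\prod_{l=1}^L L_2(\Omega_l)\to L_2(\Omega_T)^G$, $(\mathbf A\Phi)_g(\mathbf r)=\sum_{l=1}^L\Phi^{(l)}(\mathbf r+h_l\alpha_g)$, $\mathbf r\in\Omega_T$. With given weights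 $\gamma_1,\dots,\gamma_L>0$, the spaces carry the inner products $\langle\phi,\psi\rangle=\sum_{l=1}^L\frac1{\gamma_l}\langle\phi_l,\psi_l\rangle_{L_2(\Omega_l)}$ on $\prod_l L_2(\Omega_l)$ and $\langle\varphi,\psi\rangle=\sum_{g=1}^G\langle\varphi_g,\psi_g\rangle_{L_2(\Omega_T)}$ on $L_2(\Omega_T)^G$; $\mathbf A^*$ is the Hilbert space adjoint with respect to these inner products, and $(\mathbf A^*\varphi)^{(l)}$ is its $l$-th component. Functions are real-valued; pointwise identities between $L_2$ functions are understood almost everywhere. The overlap function of layer $l$ is $\omega_l(\mathbf r)=\sum_{g'=1}^G\chi_{\Omega_T(h_l\alpha_{g'})}(\mathbf r)$, where $\chi$ denotes the characteristic function. Fix $g\in\{1,\dots,G\}$ and a ball $B_{\rho_1}(\mathbf r_1)$ with center $\mathbf r_1\in\Omega_T(h_1\alpha_g)$ and radius $\rho_1>0$ such that $B_{\rho_1}(\mathbf r_1)\subset\Omega_T(h_1\alpha_g)$ and $\omega_1(\mathbf r)=1$ for all $\mathbf r\in B_{\rho_1}(\mathbf r_1)$. Define $\bar\Omega_T^g=\{\mathbf r\in\Omega_T:\mathbf r+h_1\alpha_g\in B_{\rho_1}(\mathbf r_1)\}$ and $\bar\Omega^{g,l}=\{\mathbf r+h_l\alpha_g:\mathbf r\in\bar\Omega_T^g\}$ for $l=1,\dots,L$. *)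

theory Defs
  imports "HOL-Analysis.Analysis"
begin

text \<open>
  Guide stars are indexed by \<open>{1..G}\<close> and layers by \<open>{1..L}\<close>. Elements of L2 spaces are represented
  by everywhere defined functions on the plane; only their values on the respective domain matter,
  and there only up to null sets.
\<close>

definition guide_dir :: "(nat \<Rightarrow> real) \<Rightarrow> nat \<Rightarrow> real^2" where
  "guide_dir \<theta> g = vector [cos (\<theta> g), sin (\<theta> g)]"

definition aperture :: "real \<Rightarrow> (real^2) set" where
  "aperture T = {r. norm r \<le> T}"

definition shifted_aperture :: "real \<Rightarrow> real^2 \<Rightarrow> (real^2) set" where
  "shifted_aperture T c = {r. r - c \<in> aperture T}"

definition layer_domain ::
  "nat \<Rightarrow> (nat \<Rightarrow> real) \<Rightarrow> (nat \<Rightarrow> real) \<Rightarrow> real \<Rightarrow> nat \<Rightarrow> (real^2) set" where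
  "layer_domain G \<theta> h T l = (\<Union>g\<in>{1..G}. shifted_aperture T (h l *\<^sub>R guide_dir \<theta> g))"

definition overlap ::
  "nat \<Rightarrow> (nat \<Rightarrow> real) \<Rightarrow> (nat \<Rightarrow> real) \<Rightarrow> real \<Rightarrow> nat \<Rightarrow> real^2 \<Rightarrow> real" where
  "overlap G \<theta> h T l r =
     (\<Sum>g'=1..G. indicator (shifted_aperture T (h l *\<^sub>R guide_dir \<theta> g')) r)"

definition L2_on :: "(real^2) set \<Rightarrow> (real^2 \<Rightarrow> real) set" where
  "L2_on S = {f. f \<in> borel_measurable (lebesgue_on S) \<and>
                 integrable (lebesgue_on S) (\<lambda>x. (f x)\<^sup>2)}"

definition L2_inner :: "(real^2) set \<Rightarrow> (real^2 \<Rightarrow> real) \<Rightarrow> (real^2 \<Rightarrow> real) \<Rightarrow> real" where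
  "L2_inner S f g = (LINT x|lebesgue_on S. f x * g x)"

definition layer_space ::
  "nat \<Rightarrow> nat \<Rightarrow> (nat \<Rightarrow> real) \<Rightarrow> (nat \<Rightarrow> real) \<Rightarrow> real \<Rightarrow> (nat \<Rightarrow> real^2 \<Rightarrow> real) set" where
  "layer_space G L \<theta> h T = {\<Phi>. \<forall>l\<in>{1..L}. \<Phi> l \<in> L2_on (layer_domain G \<theta> h T l)}"

definition layer_inner ::
  "nat \<Rightarrow> nat \<Rightarrow> (nat \<Rightarrow> real) \<Rightarrow> (nat \<Rightarrow> real) \<Rightarrow> real \<Rightarrow> (nat \<Rightarrow> real) \<Rightarrow>
   (nat \<Rightarrow> real^2 \<Rightarrow> real) \<Rightarrow> (nat \<Rightarrow> real^2 \<Rightarrow> real) \<Rightarrow> real" where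
  "layer_inner G L \<theta> h T \<gamma> \<Phi> \<Psi> =
     (\<Sum>l=1..L. 1 / \<gamma> l * L2_inner (layer_domain G \<theta> h T l) (\<Phi> l) (\<Psi> l))"

definition wavefront_space :: "nat \<Rightarrow> real \<Rightarrow> (nat \<Rightarrow> real^2 \<Rightarrow> real) set" where
  "wavefront_space G T = {\<phi>. \<forall>g\<in>{1..G}. \<phi> g \<in> L2_on (aperture T)}"

definition wavefront_inner ::
  "nat \<Rightarrow> real \<Rightarrow> (nat \<Rightarrow> real^2 \<Rightarrow> real) \<Rightarrow> (nat \<Rightarrow> real^2 \<Rightarrow> real) \<Rightarrow> real" where
  "wavefront_inner G T \<phi> \<psi> = (\<Sum>g=1..G. L2_inner (aperture T) (\<phi> g) (\<psi> g))"

definition tomo_op ::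
  "nat \<Rightarrow> (nat \<Rightarrow> real) \<Rightarrow> (nat \<Rightarrow> real) \<Rightarrow> (nat \<Rightarrow> real^2 \<Rightarrow> real) \<Rightarrow> nat \<Rightarrow> real^2 \<Rightarrow> real" where
  "tomo_op L \<theta> h \<Phi> g r = (\<Sum>l=1..L. \<Phi> l (r + h l *\<^sub>R guide_dir \<theta> g))"

text \<open>
  The adjoint of \<open>A : V \<rightarrow> W\<close> with respect to the inner products \<open>ipV\<close> and \<open>ipW\<close>. As the elements
  of \<open>V\<close> below are representatives of L2 classes, the defining identity fixes the value only up to
  null sets; \<open>SOME\<close> selects one representative, so the result may be used only almost everywhere.
\<close>

definition hilbert_adjoint ::
  "'v set \<Rightarrow> ('v \<Rightarrow> 'v \<Rightarrow> real) \<Rightarrow> ('w \<Rightarrow> 'w \<Rightarrow> real) \<Rightarrow> ('v \<Rightarrow> 'w) \<Rightarrow> 'w \<Rightarrow> 'v" where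
  "hilbert_adjoint V ipV ipW A y = (SOME x. x \<in> V \<and> (\<forall>v\<in>V. ipW (A v) y = ipV v x))"

definition tomo_adjoint ::
  "nat \<Rightarrow> nat \<Rightarrow> (nat \<Rightarrow> real) \<Rightarrow> (nat \<Rightarrow> real) \<Rightarrow> real \<Rightarrow> (nat \<Rightarrow> real) \<Rightarrow>
   (nat \<Rightarrow> real^2 \<Rightarrow> real) \<Rightarrow> nat \<Rightarrow> real^2 \<Rightarrow> real" where
  "tomo_adjoint G L \<theta> h T \<gamma> =
     hilbert_adjoint (layer_space G L \<theta> h T) (layer_inner G L \<theta> h T \<gamma>) (wavefront_inner G T)
       (tomo_op L \<theta> h)"

text \<open>
  The ball is taken open: this is the weaker hypothesis on the overlap function, and the sets for the
  open and the closed ball differ by a null set.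
\<close>

definition aperture_part ::
  "(nat \<Rightarrow> real) \<Rightarrow> (nat \<Rightarrow> real) \<Rightarrow> real \<Rightarrow> nat \<Rightarrow> real^2 \<Rightarrow> real \<Rightarrow> (real^2) set" where
  "aperture_part \<theta> h T g r1 \<rho>1 = {r \<in> aperture T. r + h 1 *\<^sub>R guide_dir \<theta> g \<in> ball r1 \<rho>1}"

end

theory Submission
  imports Defs
begin

text \<open>
  The adjoint is the weighted back projection: its layer \<open>l\<close> is \<open>\<gamma> l\<close> times the sum of the wavefronts
  translated to the shifted apertures. Since an L2 function is determined almost everywhere by its
  inner products, every representative chosen for the adjoint agrees with it almost everywhere. By
  convexity of the disc, if \<open>r\<close> lies in the aperture and \<open>r + h l *\<^sub>R guide_dir \<theta> g\<close> is also seen by a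
  second star, then so is \<open>r + h 1 *\<^sub>R guide_dir \<theta> g\<close>, as \<open>h 1 \<le> h l\<close>. Hence over the part of the
  aperture where layer 1 has overlap 1 only the star \<open>g\<close> contributes in every layer, and the adjoint
  reduces there to \<open>\<gamma> l * \<phi> g r\<close>.
\<close>

section \<open>Translation invariance of Lebesgue measure\<close>

lemma
  fixes c :: "'a::euclidean_space"
  shows translate_lebesgue_measurable: "(\<lambda>x. x + c) \<in> lebesgue \<rightarrow>\<^sub>M lebesgue"
    and distr_lebesgue_translate: "distr lebesgue lebesgue (\<lambda>x. x + c) = lebesgue"
proof -
  \<comment> \<open>The coordinatewise affine map with every scaling factor equal to 1 is the
    translation by \<open>c\<close>, and its density factor is 1.\<close>
  have eq: "(\<lambda>x. c + (\<Sum>j\<in>Basis. (1 * (x \<bullet> j)) *\<^sub>R j)) = (\<lambda>x. x + c)"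
    by (simp add: euclidean_representation add.commute)
  show "(\<lambda>x. x + c) \<in> lebesgue \<rightarrow>\<^sub>M lebesgue"
    using lebesgue_affine_measurable[of "\<lambda>_. 1" c] unfolding eq by simp
  show "distr lebesgue lebesgue (\<lambda>x. x + c) = lebesgue"
    using lebesgue_affine_euclidean[of "\<lambda>_. 1" c] unfolding eq by (simp add: density_1)
qed

text \<open>Translates of null sets are null. This carries statements about a layer back to the
  aperture.\<close>

lemma AE_lebesgue_translate:
  fixes c :: "'a::euclidean_space"
  assumes "AE x in lebesgue. P x"
  shows "AE x in lebesgue. P (x + c)"
proof -
  have "AE x in distr lebesgue lebesgue (\<lambda>x. x + c). P x"
    unfolding distr_lebesgue_translate by (rule assms)
  then show ?thesis
    by (rule AE_distrD[OF translate_lebesgue_measurable])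
qed

text \<open>Change of variables between \<open>S\<close> and its preimage. For \<open>S\<close> a
  shifted aperture with centre \<open>c\<close>, the preimage is the aperture itself.\<close>

lemma
  fixes c :: "'a::euclidean_space"
  assumes S: "S \<in> sets lebesgue"
  shows translate_lebesgue_on_measurable:
      "(\<lambda>x. x + c) \<in> lebesgue_on {x. x + c \<in> S} \<rightarrow>\<^sub>M lebesgue_on S"
    and distr_lebesgue_on_translate:
      "distr (lebesgue_on {x. x + c \<in> S}) (lebesgue_on S) (\<lambda>x. x + c) = lebesgue_on S"
proof -
  note m = translate_lebesgue_measurable[of c]
  have vimage: "{x. x + c \<in> A} \<in> sets lebesgue" if "A \<in> sets lebesgue" for A
    using measurable_sets[OF m that] by (simp add: vimage_def)
  show meas: "(\<lambda>x. x + c) \<in> lebesgue_on {x. x + c \<in> S} \<rightarrow>\<^sub>M lebesgue_on S"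
    by (rule measurable_restrict_space2)
      (auto simp: space_restrict_space intro!: measurable_restrict_space1 m)
  show "distr (lebesgue_on {x. x + c \<in> S}) (lebesgue_on S) (\<lambda>x. x + c) = lebesgue_on S"
  proof (rule measure_eqI)
    fix A assume "A \<in> sets (distr (lebesgue_on {x. x + c \<in> S}) (lebesgue_on S) (\<lambda>x. x + c))"
    then have A: "A \<in> sets (lebesgue_on S)" by simp
    then have A': "A \<subseteq> S" "A \<in> sets lebesgue"
      using S by (auto simp: sets_restrict_space_iff)
    \<comment> \<open>As \<open>A\<close> lies inside \<open>S\<close>, its preimage lies inside the
      restricted domain. Both restrictions can thus be dropped, and invariance on the whole space
      applies.\<close>
    have "emeasure (distr (lebesgue_on {x. x + c \<in> S}) (lebesgue_on S) (\<lambda>x. x + c)) A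
        = emeasure (lebesgue_on {x. x + c \<in> S}) {x. x + c \<in> A}"
      using A' by (subst emeasure_distr[OF meas A])
        (auto simp: space_restrict_space intro!: arg_cong2[where f = emeasure])
    also have "\<dots> = emeasure lebesgue {x. x + c \<in> A}"
      using A' vimage[OF S] by (subst emeasure_restrict_space) auto
    also have "\<dots> = emeasure (distr lebesgue lebesgue (\<lambda>x. x + c)) A"
      using A' by (subst emeasure_distr[OF m]) (auto simp: vimage_def)
    also have "\<dots> = emeasure (lebesgue_on S) A"
      using A' S by (simp add: distr_lebesgue_translate emeasure_restrict_space)
    finally show "emeasure (distr (lebesgue_on {x. x + c \<in> S}) (lebesgue_on S) (\<lambda>x. x + c)) A
        = emeasure (lebesgue_on S) A" .
  qed simp
qed

section \<open>L2 functions and their inner products\<close>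

lemma L2_on_translate:
  assumes S: "S \<in> sets lebesgue" and f: "f \<in> L2_on S"
  shows "(\<lambda>x. f (x + c)) \<in> L2_on {x. x + c \<in> S}"
proof -
  note m = translate_lebesgue_on_measurable[OF S, of c]
  have f': "f \<in> borel_measurable (lebesgue_on S)" "integrable (lebesgue_on S) (\<lambda>x. (f x)\<^sup>2)"
    using f by (auto simp: L2_on_def)
  have "integrable (lebesgue_on {x. x + c \<in> S}) (\<lambda>x. (f (x + c))\<^sup>2)"
    using integrable_distr[OF m, of "\<lambda>x. (f x)\<^sup>2"] f' distr_lebesgue_on_translate[OF S, of c]
    by simp
  then show ?thesis
    using measurable_compose[OF m f'(1)] by (simp add: L2_on_def)
qed

text \<open>The sum of the squares dominates the product. Additivity of \<open>L2_inner\<close>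
  rests on this, since the integral of a non-integrable function is 0 by default.\<close>

lemma L2_on_mult_integrable:
  assumes "f \<in> L2_on S" "g \<in> L2_on S"
  shows "integrable (lebesgue_on S) (\<lambda>x. f x * g x)"
proof (rule Bochner_Integration.integrable_bound)
  show "integrable (lebesgue_on S) (\<lambda>x. (f x)\<^sup>2 + (g x)\<^sup>2)"
    using assms by (auto simp: L2_on_def)
  show "(\<lambda>x. f x * g x) \<in> borel_measurable (lebesgue_on S)"
    using assms by (auto simp: L2_on_def)
  have "\<bar>a * b\<bar> \<le> a\<^sup>2 + b\<^sup>2" for a b :: real
  proof -
    have "2 * \<bar>a * b\<bar> \<le> a\<^sup>2 + b\<^sup>2"
      using sum_squares_bound[of "\<bar>a\<bar>" "\<bar>b\<bar>"] by (simp add: abs_mult)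
    then show ?thesis using abs_ge_zero[of "a * b"] by linarith
  qed
  then show "AE x in lebesgue_on S. norm (f x * g x) \<le> norm ((f x)\<^sup>2 + (g x)\<^sup>2)"
    by auto
qed

lemma L2_on_zero: "(\<lambda>_. 0) \<in> L2_on S"
  by (simp add: L2_on_def)

text \<open>The cross term of the expanded square is integrable by the product bound.\<close>

lemma L2_on_add:
  assumes "f \<in> L2_on S" "g \<in> L2_on S"
  shows "(\<lambda>x. f x + g x) \<in> L2_on S"
  using assms L2_on_mult_integrable[OF assms]
  by (auto simp: L2_on_def power2_sum mult.assoc)

lemma L2_on_cmult:
  assumes "f \<in> L2_on S"
  shows "(\<lambda>x. a * f x) \<in> L2_on S"
  using assms by (auto simp: L2_on_def power_mult_distrib)

lemma L2_on_diff:
  assumes "f \<in> L2_on S" "g \<in> L2_on S"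
  shows "(\<lambda>x. f x - g x) \<in> L2_on S"
  using L2_on_add[OF assms(1) L2_on_cmult[OF assms(2), of "-1"]] by simp

lemma L2_on_sum:
  assumes "\<And>i. i \<in> I \<Longrightarrow> f i \<in> L2_on S"
  shows "(\<lambda>x. \<Sum>i\<in>I. f i x) \<in> L2_on S"
  using assms by (induction I rule: infinite_finite_induct) (auto intro: L2_on_zero L2_on_add)

text \<open>Passing to the whole plane reduces restriction to a subset and extension by zero to
  multiplication by an indicator.\<close>

lemma L2_on_iff_UNIV:
  assumes "S \<in> sets lebesgue"
  shows "f \<in> L2_on S \<longleftrightarrow> (\<lambda>x. indicator S x * f x) \<in> L2_on UNIV"
proof -
  have "(indicator S x * f x)\<^sup>2 = indicator S x * (f x)\<^sup>2" for x
    by (simp add: indicator_def)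
  then show ?thesis
    using assms
    by (simp add: L2_on_def borel_measurable_restrict_space_iff integrable_restrict_space
        lebesgue_on_UNIV_eq)
qed

lemma L2_on_mult_indicator:
  assumes "S \<in> sets lebesgue" "f \<in> L2_on D"
  shows "(\<lambda>x. indicator S x * f x) \<in> L2_on D"
proof -
  have [measurable]: "f \<in> borel_measurable (lebesgue_on D)"
    using assms by (simp add: L2_on_def)
  have "(indicator S :: _ \<Rightarrow> real) \<in> borel_measurable (lebesgue_on D)"
    using assms by (intro measurable_restrict_space1) auto
  then have *: "(\<lambda>x. indicator S x * f x) \<in> borel_measurable (lebesgue_on D)"
    by measurable
  have "integrable (lebesgue_on D) (\<lambda>x. (indicator S x * f x)\<^sup>2)"
    by (rule Bochner_Integration.integrable_bound[of _ "\<lambda>x. (f x)\<^sup>2"])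
      (use assms * in \<open>auto simp: L2_on_def indicator_def\<close>)
  with * show ?thesis by (simp add: L2_on_def)
qed

lemma L2_on_subset:
  assumes "S \<in> sets lebesgue" "D \<in> sets lebesgue" "S \<subseteq> D" "f \<in> L2_on D"
  shows "f \<in> L2_on S"
proof -
  have eq: "indicator S x * (indicator D x * f x) = indicator S x * f x" for x
    using assms(3) by (auto simp: indicator_def)
  have "(\<lambda>x. indicator D x * f x) \<in> L2_on UNIV"
    using assms(4) L2_on_iff_UNIV[OF assms(2)] by blast
  then have "(\<lambda>x. indicator S x * (indicator D x * f x)) \<in> L2_on UNIV"
    by (rule L2_on_mult_indicator[OF assms(1)])
  then show ?thesis
    unfolding eq L2_on_iff_UNIV[OF assms(1), symmetric] .
qed

lemma L2_on_extend:
  assumes "S \<in> sets lebesgue" "D \<in> sets lebesgue" "f \<in> L2_on S"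
  shows "(\<lambda>x. indicator S x * f x) \<in> L2_on D"
proof -
  have "(\<lambda>x. indicator S x * f x) \<in> L2_on UNIV"
    using assms(3) L2_on_iff_UNIV[OF assms(1)] by blast
  then show ?thesis
    unfolding L2_on_iff_UNIV[OF assms(2)] by (rule L2_on_mult_indicator[OF assms(2)])
qed

text \<open>With the indicators inserted, both sides integrate the same function over the plane.
  This gathers integrals over the different shifted apertures into inner products on one layer
  domain.\<close>

lemma L2_inner_extend:
  assumes "S \<in> sets lebesgue" "D \<in> sets lebesgue" "S \<subseteq> D"
  shows "L2_inner D f (\<lambda>x. indicator S x * g x) = L2_inner S f g"
proof -
  have eq: "indicator D x * (f x * (indicator S x * g x)) = indicator S x * (f x * g x)" for x
    using assms(3) by (auto simp: indicator_def)
  have "L2_inner D f (\<lambda>x. indicator S x * g x)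
      = (LINT x|lebesgue. indicator D x * (f x * (indicator S x * g x)))"
    using assms(2) by (simp add: L2_inner_def integral_restrict_space)
  also have "\<dots> = L2_inner S f g"
    unfolding eq using assms(1) by (simp add: L2_inner_def integral_restrict_space)
  finally show ?thesis .
qed

text \<open>Substituting \<open>x + c\<close> moves the shift from \<open>f\<close> to the opposite
  shift of \<open>g\<close>: on a single aperture, this is the adjoint of a translation.\<close>

lemma L2_inner_translate:
  assumes S: "S \<in> sets lebesgue" and f: "f \<in> L2_on S" and g: "g \<in> L2_on {x. x + c \<in> S}"
  shows "L2_inner {x. x + c \<in> S} (\<lambda>x. f (x + c)) g = L2_inner S f (\<lambda>x. g (x - c))"
proof -
  note m = translate_lebesgue_on_measurable[OF S, of c]
  have vimage: "{x. x + c \<in> S} \<in> sets lebesgue"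
    using measurable_sets[OF translate_lebesgue_measurable[of c] S] by (simp add: vimage_def)
  \<comment> \<open>Translating the preimage by \<open>-c\<close> gives back
    \<open>S\<close>.\<close>
  have "(\<lambda>x. g (x - c)) \<in> L2_on S"
    using L2_on_translate[OF vimage g, of "-c"] by simp
  then have "(\<lambda>x. f x * g (x - c)) \<in> borel_measurable (lebesgue_on S)"
    using f by (auto simp: L2_on_def)
  from integral_distr[OF m this] show ?thesis
    by (simp add: L2_inner_def distr_lebesgue_on_translate[OF S])
qed

lemma L2_inner_sum_left:
  assumes "\<And>i. i \<in> I \<Longrightarrow> f i \<in> L2_on S" "g \<in> L2_on S"
  shows "L2_inner S (\<lambda>x. \<Sum>i\<in>I. f i x) g = (\<Sum>i\<in>I. L2_inner S (f i) g)"
  unfolding L2_inner_def sum_distrib_right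
  by (intro Bochner_Integration.integral_sum L2_on_mult_integrable assms)

lemma L2_inner_sum_right:
  assumes "\<And>i. i \<in> I \<Longrightarrow> g i \<in> L2_on S" "f \<in> L2_on S"
  shows "L2_inner S f (\<lambda>x. \<Sum>i\<in>I. g i x) = (\<Sum>i\<in>I. L2_inner S f (g i))"
  unfolding L2_inner_def sum_distrib_left
  by (intro Bochner_Integration.integral_sum L2_on_mult_integrable assms)

lemma L2_inner_cmult_right: "L2_inner S f (\<lambda>x. a * g x) = a * L2_inner S f g"
  unfolding L2_inner_def by (simp add: mult.left_commute)

lemma L2_inner_diff_right:
  assumes "f \<in> L2_on S" "g \<in> L2_on S" "u \<in> L2_on S"
  shows "L2_inner S u (\<lambda>x. f x - g x) = L2_inner S u f - L2_inner S u g"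
  unfolding L2_inner_def right_diff_distrib
  by (intro Bochner_Integration.integral_diff L2_on_mult_integrable assms)

text \<open>Testing with \<open>u = f - g\<close> shows that the difference has norm zero, so it
  vanishes almost everywhere.\<close>

lemma AE_eq_if_L2_inner_eq:
  assumes S: "S \<in> sets lebesgue" and f: "f \<in> L2_on S" and g: "g \<in> L2_on S"
    and eq: "\<And>u. u \<in> L2_on S \<Longrightarrow> L2_inner S u f = L2_inner S u g"
  shows "AE x in lebesgue. x \<in> S \<longrightarrow> f x = g x"
proof -
  let ?d = "\<lambda>x. f x - g x"
  have d: "?d \<in> L2_on S" by (rule L2_on_diff[OF f g])
  have "L2_inner S ?d ?d = 0"
    using L2_inner_diff_right[OF f g d] eq[OF d] by simp
  then have "AE x in lebesgue_on S. ?d x * ?d x = 0"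
    unfolding L2_inner_def
    by (subst (asm) integral_nonneg_eq_0_iff_AE[OF L2_on_mult_integrable[OF d d]]) auto
  then show ?thesis
    using S by (simp add: AE_restrict_space_iff)
qed

section \<open>Apertures and layer domains\<close>

lemma aperture_lebesgue: "aperture T \<in> sets lebesgue"
proof -
  have "aperture T = cball 0 T" by (auto simp: aperture_def)
  then show ?thesis by simp
qed

lemma shifted_aperture_eq_cball: "shifted_aperture T c = cball c T"
  by (auto simp: shifted_aperture_def aperture_def dist_norm norm_minus_commute)

lemma shifted_aperture_lebesgue: "shifted_aperture T c \<in> sets lebesgue"
  by (simp add: shifted_aperture_eq_cball)

lemma layer_domain_lebesgue: "layer_domain G \<theta> h T l \<in> sets lebesgue"
  unfolding layer_domain_def by (intro sets.finite_UN shifted_aperture_lebesgue) auto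

lemma shifted_aperture_subset_layer_domain:
  "g \<in> {1..G} \<Longrightarrow> shifted_aperture T (h l *\<^sub>R guide_dir \<theta> g) \<subseteq> layer_domain G \<theta> h T l"
  by (auto simp: layer_domain_def)

lemma translate_shifted_aperture: "{x. x + c \<in> shifted_aperture T c} = aperture T"
  by (auto simp: shifted_aperture_def)

section \<open>The adjoint as a weighted back projection\<close>

definition back_projection ::
  "nat \<Rightarrow> (nat \<Rightarrow> real) \<Rightarrow> (nat \<Rightarrow> real) \<Rightarrow> real \<Rightarrow> (nat \<Rightarrow> real) \<Rightarrow>
   (nat \<Rightarrow> real^2 \<Rightarrow> real) \<Rightarrow> nat \<Rightarrow> real^2 \<Rightarrow> real" where
  "back_projection G \<theta> h T \<gamma> \<phi> l r = \<gamma> l * (\<Sum>g=1..G.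
     indicator (shifted_aperture T (h l *\<^sub>R guide_dir \<theta> g)) r * \<phi> g (r - h l *\<^sub>R guide_dir \<theta> g))"

context
  fixes G :: nat and \<theta> h :: "nat \<Rightarrow> real" and T :: real and \<phi> :: "nat \<Rightarrow> real^2 \<Rightarrow> real"
  assumes \<phi>: "\<phi> \<in> wavefront_space G T"
begin

lemma wavefront_translate_L2:
  assumes "g \<in> {1..G}"
  shows "(\<lambda>r. \<phi> g (r - c)) \<in> L2_on (shifted_aperture T c)"
  using L2_on_translate[OF aperture_lebesgue, of "\<phi> g" T "- c"] assms \<phi>
  by (simp add: wavefront_space_def shifted_aperture_def)

text \<open>A wavefront is arbitrary outside the aperture. The indicator replaces those values by
  zero, which makes its translate an L2 function on the entire layer domain.\<close>

lemma back_projection_summand_L2: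
  assumes "g \<in> {1..G}"
  shows "(\<lambda>r. indicator (shifted_aperture T c) r * \<phi> g (r - c)) \<in> L2_on (layer_domain G \<theta> h T l)"
  by (rule L2_on_extend[OF shifted_aperture_lebesgue layer_domain_lebesgue
        wavefront_translate_L2[OF assms]])

lemma back_projection_in_layer_space: "back_projection G \<theta> h T \<gamma> \<phi> \<in> layer_space G L \<theta> h T"
  unfolding layer_space_def back_projection_def
  by (intro CollectI ballI L2_on_cmult L2_on_sum back_projection_summand_L2)

text \<open>For each pair of star and layer the shift is moved onto the wavefront; then the sums
  over stars and layers are exchanged.\<close>

lemma back_projection_is_adjoint:
  assumes \<gamma>: "\<forall>i\<in>{1..L}. \<gamma> i > 0" and \<Phi>: "\<Phi> \<in> layer_space G L \<theta> h T"
  shows "wavefront_inner G T (tomo_op L \<theta> h \<Phi>) \<phi>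
    = layer_inner G L \<theta> h T \<gamma> \<Phi> (back_projection G \<theta> h T \<gamma> \<phi>)"
proof -
  define c where "c = (\<lambda>l g. h l *\<^sub>R guide_dir \<theta> g)"
  define D where "D = layer_domain G \<theta> h T"
  have \<Phi>_D: "\<Phi> l \<in> L2_on (D l)" if "l \<in> {1..L}" for l
    using \<Phi> that by (simp add: layer_space_def D_def)
  have sub: "shifted_aperture T (c l g) \<subseteq> D l" if "g \<in> {1..G}" for l g
    using shifted_aperture_subset_layer_domain[OF that] by (simp add: c_def D_def)
  have D: "D l \<in> sets lebesgue" for l
    by (simp add: D_def layer_domain_lebesgue)
  have \<Phi>_S: "\<Phi> l \<in> L2_on (shifted_aperture T (c l g))" if "l \<in> {1..L}" "g \<in> {1..G}" for l g
    by (rule L2_on_subset[OF shifted_aperture_lebesgue D sub \<Phi>_D]) (use that in auto)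
  have \<Phi>_A: "(\<lambda>r. \<Phi> l (r + c l g)) \<in> L2_on (aperture T)" if "l \<in> {1..L}" "g \<in> {1..G}" for l g
    using L2_on_translate[OF shifted_aperture_lebesgue \<Phi>_S[OF that], of "c l g"]
    by (simp add: translate_shifted_aperture)
  have \<phi>_A: "\<phi> g \<in> L2_on (aperture T)" if "g \<in> {1..G}" for g
    using \<phi> that by (simp add: wavefront_space_def)
  let ?\<psi> = "\<lambda>l g r. indicator (shifted_aperture T (c l g)) r * \<phi> g (r - c l g)"
  \<comment> \<open>First the integral is translated from the aperture to the shifted aperture, then
    the wavefront is extended by zero to the layer domain.\<close>
  have term_eq: "L2_inner (aperture T) (\<lambda>r. \<Phi> l (r + c l g)) (\<phi> g) = L2_inner (D l) (\<Phi> l) (?\<psi> l g)"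
    if "l \<in> {1..L}" "g \<in> {1..G}" for l g
    using L2_inner_translate[OF shifted_aperture_lebesgue \<Phi>_S[OF that], of "\<phi> g" "c l g"]
      \<phi>_A[OF that(2)] L2_inner_extend[OF shifted_aperture_lebesgue D sub[OF that(2)]]
    by (simp add: translate_shifted_aperture)
  have "wavefront_inner G T (tomo_op L \<theta> h \<Phi>) \<phi>
      = (\<Sum>g=1..G. L2_inner (aperture T) (\<lambda>r. \<Sum>l=1..L. \<Phi> l (r + c l g)) (\<phi> g))"
    by (simp add: wavefront_inner_def tomo_op_def[abs_def] c_def)
  also have "\<dots> = (\<Sum>g=1..G. \<Sum>l=1..L. L2_inner (D l) (\<Phi> l) (?\<psi> l g))"
    by (intro sum.cong refl, subst L2_inner_sum_left) (auto intro!: \<Phi>_A \<phi>_A term_eq sum.cong)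
  also have "\<dots> = (\<Sum>l=1..L. \<Sum>g=1..G. L2_inner (D l) (\<Phi> l) (?\<psi> l g))"
    by (rule sum.swap)
  also have "\<dots> = (\<Sum>l=1..L. 1 / \<gamma> l * L2_inner (D l) (\<Phi> l) (back_projection G \<theta> h T \<gamma> \<phi> l))"
  proof (intro sum.cong refl)
    fix l assume l: "l \<in> {1..L}"
    have "L2_inner (D l) (\<Phi> l) (back_projection G \<theta> h T \<gamma> \<phi> l)
        = \<gamma> l * L2_inner (D l) (\<Phi> l) (\<lambda>r. \<Sum>g=1..G. ?\<psi> l g r)"
      by (simp add: back_projection_def[abs_def] L2_inner_cmult_right c_def)
    also have "\<dots> = \<gamma> l * (\<Sum>g=1..G. L2_inner (D l) (\<Phi> l) (?\<psi> l g))"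
      using back_projection_summand_L2 \<Phi>_D[OF l]
      by (subst L2_inner_sum_right) (auto simp: D_def)
    \<comment> \<open>The factor \<open>\<gamma> l\<close> of the back projection cancels the weight
      of the layer inner product.\<close>
    finally show "(\<Sum>g=1..G. L2_inner (D l) (\<Phi> l) (?\<psi> l g))
        = 1 / \<gamma> l * L2_inner (D l) (\<Phi> l) (back_projection G \<theta> h T \<gamma> \<phi> l)"
      using \<gamma> l by force
  qed
  finally show ?thesis
    by (simp add: layer_inner_def D_def)
qed

text \<open>The chosen representative and the back projection satisfy the same defining identity,
  and the inner product determines each layer up to a null set.\<close>

lemma tomo_adjoint_AE_eq_back_projection:
  assumes \<gamma>: "\<forall>i\<in>{1..L}. \<gamma> i > 0" and l: "l \<in> {1..L}"
  shows "AE r in lebesgue. r \<in> layer_domain G \<theta> h T l \<longrightarrow>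
    tomo_adjoint G L \<theta> h T \<gamma> \<phi> l r = back_projection G \<theta> h T \<gamma> \<phi> l r"
proof (rule AE_eq_if_L2_inner_eq[OF layer_domain_lebesgue])
  let ?V = "layer_space G L \<theta> h T" and ?b = "back_projection G \<theta> h T \<gamma> \<phi>"
  let ?x = "tomo_adjoint G L \<theta> h T \<gamma> \<phi>" and ?D = "layer_domain G \<theta> h T"
  have x: "?x \<in> ?V \<and> (\<forall>v\<in>?V. wavefront_inner G T (tomo_op L \<theta> h v) \<phi>
      = layer_inner G L \<theta> h T \<gamma> v ?x)"
    unfolding tomo_adjoint_def hilbert_adjoint_def
    \<comment> \<open>The back projection is the witness that makes the choice by
      \<open>SOME\<close> meaningful.\<close>
    by (rule someI[of _ ?b])
      (use back_projection_in_layer_space back_projection_is_adjoint[OF \<gamma>] in blast)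
  then show "?x l \<in> L2_on (?D l)"
    using l by (simp add: layer_space_def)
  show "?b l \<in> L2_on (?D l)"
    using back_projection_in_layer_space[of \<gamma> L] l by (simp add: layer_space_def)
  fix u assume u: "u \<in> L2_on (?D l)"
  \<comment> \<open>An element supported on layer \<open>l\<close> alone reduces the identity for
    all layers to one for layer \<open>l\<close>, up to the nonzero factor
    \<open>1 / \<gamma> l\<close>.\<close>
  define v where "v = (\<lambda>i r. if i = l then u r else 0)"
  have "v i \<in> L2_on (?D i)" for i
    by (cases "i = l") (simp_all add: v_def u L2_on_zero)
  then have v: "v \<in> ?V"
    by (simp add: layer_space_def)
  have "layer_inner G L \<theta> h T \<gamma> v y = 1 / \<gamma> l * L2_inner (?D l) u (y l)" for y
  proof -
    have "layer_inner G L \<theta> h T \<gamma> v y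
        = (\<Sum>i=1..L. if i = l then 1 / \<gamma> l * L2_inner (?D l) u (y l) else 0)"
      unfolding layer_inner_def by (intro sum.cong refl) (auto simp: v_def L2_inner_def)
    then show ?thesis using l by simp
  qed
  moreover have "layer_inner G L \<theta> h T \<gamma> v ?x = layer_inner G L \<theta> h T \<gamma> v ?b"
    using x v back_projection_is_adjoint[OF \<gamma> v] by metis
  ultimately show "L2_inner (?D l) u (?x l) = L2_inner (?D l) u (?b l)"
    using \<gamma> l by (metis divide_eq_0_iff less_irrefl mult_cancel_left zero_neq_one)
qed

end

section \<open>Points seen by a single star, and comparison of layers\<close>

lemma aperture_part_lebesgue: "aperture_part \<theta> h T g r1 \<rho>1 \<in> sets lebesgue"
proof -
  have "aperture_part \<theta> h T g r1 \<rho>1 = cball 0 T \<inter> ball (r1 - h 1 *\<^sub>R guide_dir \<theta> g) \<rho>1"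
    by (auto simp: aperture_part_def aperture_def dist_norm algebra_simps)
  then show ?thesis by simp
qed

text \<open>The overlap counts the shifted apertures containing \<open>r\<close>, so two distinct
  stars would already contribute 2.\<close>

lemma overlap_eq_1_unique:
  assumes "overlap G \<theta> h T l r = 1" "g \<in> {1..G}" "g' \<in> {1..G}"
    and "r \<in> shifted_aperture T (h l *\<^sub>R guide_dir \<theta> g)"
    and "r \<in> shifted_aperture T (h l *\<^sub>R guide_dir \<theta> g')"
  shows "g = g'"
proof (rule ccontr)
  let ?i = "\<lambda>g. indicator (shifted_aperture T (h l *\<^sub>R guide_dir \<theta> g)) r :: real"
  assume "g \<noteq> g'"
  then have "2 = (\<Sum>i\<in>{g, g'}. ?i i)"
    using assms by simp
  also have "\<dots> \<le> (\<Sum>i=1..G. ?i i)"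
    using assms by (intro sum_mono2) auto
  finally show False
    using assms(1) by (simp add: overlap_def)
qed

text \<open>Relative to the centre \<open>s *\<^sub>R b\<close> the point is
  \<open>r + s *\<^sub>R (a - b)\<close>. It divides the segment from \<open>r\<close> to
  \<open>r + t *\<^sub>R (a - b)\<close> in the ratio given by \<open>u = s / t\<close>, and both
  endpoints lie in the disc.\<close>

lemma shifted_aperture_lower_layer:
  assumes "r \<in> aperture T" "r + t *\<^sub>R a \<in> shifted_aperture T (t *\<^sub>R b)"
    and "0 < s" "s \<le> t"
  shows "r + s *\<^sub>R a \<in> shifted_aperture T (s *\<^sub>R b)"
proof -
  define u where "u = s / t"
  have u: "0 \<le> u" "u \<le> 1" "u * t = s"
    using assms by (auto simp: u_def)
  have "r \<in> cball 0 T" "r + t *\<^sub>R (a - b) \<in> cball 0 T"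
    using assms by (auto simp: aperture_def shifted_aperture_def algebra_simps)
  then have "(1 - u) *\<^sub>R r + u *\<^sub>R (r + t *\<^sub>R (a - b)) \<in> cball 0 T"
    using u by (intro convexD[OF convex_cball]) auto
  also have "(1 - u) *\<^sub>R r + u *\<^sub>R (r + t *\<^sub>R (a - b)) = r + (u * t) *\<^sub>R (a - b)"
    by (simp add: algebra_simps)
  finally show ?thesis
    using u by (simp add: shifted_aperture_def aperture_def algebra_simps)
qed

lemma back_projection_single_star:
  assumes g: "g \<in> {1..G}" and h: "0 < h 1" "h 1 \<le> h l"
    and overlap: "overlap G \<theta> h T 1 (r + h 1 *\<^sub>R guide_dir \<theta> g) = 1"
    and r: "r \<in> aperture T"
  shows "back_projection G \<theta> h T \<gamma> \<phi> l (r + h l *\<^sub>R guide_dir \<theta> g) = \<gamma> l * \<phi> g r"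
proof -
  let ?r = "r + h l *\<^sub>R guide_dir \<theta> g"
  \<comment> \<open>A star seeing the point in layer \<open>l\<close> also sees the corresponding
    point in layer 1, where the overlap leaves room for \<open>g\<close> only.\<close>
  have "g' = g" if "g' \<in> {1..G}" "?r \<in> shifted_aperture T (h l *\<^sub>R guide_dir \<theta> g')" for g'
    using overlap_eq_1_unique[OF overlap that(1) g] r
      shifted_aperture_lower_layer[OF r that(2) h]
    by (simp add: shifted_aperture_def)
  then have "(\<Sum>g'=1..G. indicator (shifted_aperture T (h l *\<^sub>R guide_dir \<theta> g')) ?r
        * \<phi> g' (?r - h l *\<^sub>R guide_dir \<theta> g'))
      = (\<Sum>g'=1..G. if g' = g then \<phi> g r else 0)"
    using r by (intro sum.cong refl) (auto simp: indicator_def shifted_aperture_def)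
  then show ?thesis
    using g by (simp add: back_projection_def)
qed

theorem proposition3p7:
  fixes G L g l k :: nat and \<theta> h \<gamma> :: "nat \<Rightarrow> real" and T \<rho>1 :: real
    and r1 :: "real^2" and \<phi> :: "nat \<Rightarrow> real^2 \<Rightarrow> real"
  assumes "G \<ge> 1" and "L \<ge> 1"
    and "\<forall>i\<in>{1..G}. 0 \<le> \<theta> i \<and> \<theta> i < 2 * pi"
    and "\<forall>i\<in>{1..<G}. \<theta> i < \<theta> (i + 1)"
    and "inj_on (guide_dir \<theta>) {1..G}"
    and "0 < h 1" and "\<forall>i\<in>{1..<L}. h i < h (i + 1)"
    and "T > 0"
    and "\<forall>i\<in>{1..L}. \<gamma> i > 0"
    and "g \<in> {1..G}"
    and "r1 \<in> shifted_aperture T (h 1 *\<^sub>R guide_dir \<theta> g)"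
    and "\<rho>1 > 0"
    and "ball r1 \<rho>1 \<subseteq> shifted_aperture T (h 1 *\<^sub>R guide_dir \<theta> g)"
    and "\<forall>r\<in>ball r1 \<rho>1. overlap G \<theta> h T 1 r = 1"
    and "l \<in> {1..L}" and "k \<in> {1..L}"
    and "\<phi> \<in> wavefront_space G T"
  shows "AE r in lebesgue_on (aperture_part \<theta> h T g r1 \<rho>1).
           tomo_adjoint G L \<theta> h T \<gamma> \<phi> l (r + h l *\<^sub>R guide_dir \<theta> g)
             = \<gamma> l / \<gamma> k * tomo_adjoint G L \<theta> h T \<gamma> \<phi> k (r + h k *\<^sub>R guide_dir \<theta> g)"
proof -
  let ?P = "aperture_part \<theta> h T g r1 \<rho>1"
  have h_mono: "h 1 \<le> h i" if "i \<in> {1..L}" for i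
  proof -
    from that have "1 \<le> i" by simp
    then show ?thesis
      using that
    proof (induction i rule: dec_induct)
      \<comment> \<open>Here \<open>Suc n\<close> is at most \<open>L\<close>, so \<open>n\<close>
        lies in \<open>{1..<L}\<close>, where consecutive heights are compared.\<close>
      case (step n)
      then have "h n < h (n + 1)" using assms(7) by auto
      with step show ?case by auto
    qed simp
  qed
  \<comment> \<open>Every layer is reduced to the same function \<open>\<phi> g r\<close>, so the
    layers differ only in the factor \<open>\<gamma> i\<close>.\<close>
  have adjoint: "AE r in lebesgue. r \<in> ?P \<longrightarrow>
      tomo_adjoint G L \<theta> h T \<gamma> \<phi> i (r + h i *\<^sub>R guide_dir \<theta> g) = \<gamma> i * \<phi> g r"
    if i: "i \<in> {1..L}" for i
  proof -
    have unfold_back: "r + h i *\<^sub>R guide_dir \<theta> g \<in> layer_domain G \<theta> h T i"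
      "back_projection G \<theta> h T \<gamma> \<phi> i (r + h i *\<^sub>R guide_dir \<theta> g) = \<gamma> i * \<phi> g r"
      if "r \<in> ?P" for r
    proof -
      have r: "r \<in> aperture T" "overlap G \<theta> h T 1 (r + h 1 *\<^sub>R guide_dir \<theta> g) = 1"
        using that assms(14) by (auto simp: aperture_part_def)
      have "r + h i *\<^sub>R guide_dir \<theta> g \<in> shifted_aperture T (h i *\<^sub>R guide_dir \<theta> g)"
        using r(1) by (simp add: shifted_aperture_def)
      then show "r + h i *\<^sub>R guide_dir \<theta> g \<in> layer_domain G \<theta> h T i"
        using shifted_aperture_subset_layer_domain[OF assms(10)] by blast
      show "back_projection G \<theta> h T \<gamma> \<phi> i (r + h i *\<^sub>R guide_dir \<theta> g) = \<gamma> i * \<phi> g r"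
        by (rule back_projection_single_star[where l = i, OF assms(10,6) h_mono[OF i] r(2,1)])
    qed
    \<comment> \<open>The almost everywhere identity on the layer domain is pulled back along the
      shift belonging to star \<open>g\<close>; points of \<open>?P\<close> land in that
      domain.\<close>
    have "AE r in lebesgue.
        r + h i *\<^sub>R guide_dir \<theta> g \<in> layer_domain G \<theta> h T i \<longrightarrow>
        tomo_adjoint G L \<theta> h T \<gamma> \<phi> i (r + h i *\<^sub>R guide_dir \<theta> g)
          = back_projection G \<theta> h T \<gamma> \<phi> i (r + h i *\<^sub>R guide_dir \<theta> g)"
      by (rule AE_lebesgue_translate[OF tomo_adjoint_AE_eq_back_projection[OF assms(17,9) i]])
    then show ?thesis
      by (rule eventually_mono) (use unfold_back in metis)
  qed
  have "\<gamma> k \<noteq> 0"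
    using assms(9,16) by force
  \<comment> \<open>Outside the union of the two exceptional null sets, \<open>\<gamma> k\<close>
    cancels and both sides equal \<open>\<gamma> l * \<phi> g r\<close>.\<close>
  have "AE r in lebesgue. r \<in> ?P \<longrightarrow>
      tomo_adjoint G L \<theta> h T \<gamma> \<phi> l (r + h l *\<^sub>R guide_dir \<theta> g)
        = \<gamma> l / \<gamma> k * tomo_adjoint G L \<theta> h T \<gamma> \<phi> k (r + h k *\<^sub>R guide_dir \<theta> g)"
    using adjoint[OF assms(15)] adjoint[OF assms(16)]
    by eventually_elim (use \<open>\<gamma> k \<noteq> 0\<close> in simp)
  then show ?thesis
    by (simp add: AE_restrict_space_iff aperture_part_lebesgue)
qed

end
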